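(* ODF implies DC. That is, suppose there is $C>0$ such that for all $n$ and all $v\in V_n$, $|v|\le C|Pv|$. Then for every infinite subset $N\subseteq\mathbb N$ and every family $(v_n)_{n\in N}$ with $v_n\in V_n$ that is bounded in $X$, there is a subsequence converging strongly in $O$ to an element of $V$.
   Context: Setting. $O$ is an infinite dimensional separable real Hilbert space with scalar product $\langle\cdot,\cdot\rangle$ and norm $|\cdot|$. $X\subseteq O$ is a dense subspace, itself a Hilbert space with continuous inclusion $X\to O$. $a$ is a continuous symmetric bilinear form on $X$ with $a(u,u)\ge 0$ for all $u\in X$, such that $\langle\cdot,\cdot\rangle+a$ is coercive on $X$; this form is taken as the scalar product of $X$, so $\|u\|^2=|u|^2+a(u,u)$ is the norm of $X$. Define $W=\{u\in X: a(u,u')=0\ \forall u'\in X\}$ and $V=\{u\in X:\langle u,w\rangle=0\ \forall w\in W\}$, so $X=V\oplus W$; $W$ is closed in $O$ and may be infinite dimensional. $\overline V$ is the closure of $V$ in $O$; it is the $O$-orthogonal complement of $W$. $P$ is the $O$-orthogonal projector in $O$ with range $\overline V$ and kernel $W$. It is assumed that the injection $V\to O$ is compact ($V$ carrying the norm of $X$). Discretization. $(X_n)_{n\in\mathbb N}$ is a sequence of finite dimensional subspaces of $X$ satisfying AS: for all $u\in X$, $\lim_{n\to\infty}\inf_{u'\in X_n}\|u-u'\|=0$. Define $W_n=\{u\in X_n: a(u,u')=0\ \forall u'\in X_n\}=X_n\cap W$ and $V_n=\{u\in X_n:\langle u,w\rangle=0\ \forall w\in W_n\}$, so $X_n=V_n\oplus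 W_n$ ($V_n$ need not be contained in $V$). *)

theory Defs
  imports "HOL-Analysis.Analysis"
begin

text \<open>
  The energy space \<open>X\<close> is the type \<open>'x\<close> with its own inner product and norm; the inclusion
  into the pivot space is a map \<open>\<iota>\<close> from \<open>'x\<close> to \<open>'o\<close>. The two definitions below are relative to a
  subspace \<open>S\<close> of \<open>X\<close>: \<open>S = UNIV\<close> gives \<open>W\<close> and \<open>V\<close>, and \<open>S = Xn n\<close> gives \<open>W\<^sub>n\<close> and \<open>V\<^sub>n\<close>.
\<close>

definition form_kernel :: "('x \<Rightarrow> 'x \<Rightarrow> real) \<Rightarrow> 'x set \<Rightarrow> 'x set" where
  "form_kernel a S = {u \<in> S. \<forall>u'\<in>S. a u u' = 0}"

definition kernel_complement ::
    "('x \<Rightarrow> 'o::real_inner) \<Rightarrow> ('x \<Rightarrow> 'x \<Rightarrow> real) \<Rightarrow> 'x set \<Rightarrow> 'x set" where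
  "kernel_complement \<iota> a S = {u \<in> S. \<forall>w\<in>form_kernel a S. \<iota> u \<bullet> \<iota> w = 0}"

text \<open>
  The projector with range \<open>R\<close> and kernel \<open>K\<close>, for complementary subspaces \<open>R\<close> and \<open>K\<close>. It is
  the orthogonal projector onto \<open>R\<close> exactly when \<open>R\<close> and \<open>K\<close> are orthogonal.
\<close>

definition projector :: "'o::real_vector set \<Rightarrow> 'o set \<Rightarrow> 'o \<Rightarrow> 'o" where
  "projector R K x = (THE y. y \<in> R \<and> x - y \<in> K)"

text \<open>
  \<open>V\<close> is orthogonal to \<open>W\<close> by definition, hence so is its closure, and the two are complementary
  when the range of \<open>\<iota>\<close> is dense and \<open>W\<close> is closed in \<open>'o\<close>. Thus the following is the orthogonal
  projector.
\<close>

definition kernel_projector ::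
    "('x \<Rightarrow> 'o::real_inner) \<Rightarrow> ('x \<Rightarrow> 'x \<Rightarrow> real) \<Rightarrow> 'o \<Rightarrow> 'o" where
  "kernel_projector \<iota> a =
     projector (closure (\<iota> ` kernel_complement \<iota> a UNIV)) (\<iota> ` form_kernel a UNIV)"

definition finite_dimensional :: "'v::real_vector set \<Rightarrow> bool" where
  "finite_dimensional S \<longleftrightarrow> (\<exists>B. finite B \<and> span B = S)"

definition compact_map_on ::
    "'v::real_normed_vector set \<Rightarrow> ('v \<Rightarrow> 'w::real_normed_vector) \<Rightarrow> bool" where
  "compact_map_on S f \<longleftrightarrow> (\<forall>B\<subseteq>S. bounded B \<longrightarrow> compact (closure (f ` B)))"

end

(* Split v_n = p_n + w_n along X = V + W.  Compactness gives a subsequence with p_n -> z in O, and z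
   lies in V because a sequence that is bounded in X can only converge in O to an element of X.
   Approximate this element u by u_n in X_n and let v'_n be the V_n-component of u_n.  The
   W_n-component of u_n tends to 0, as it is the O-projection of u_n onto a space orthogonal to u.
   Hence v'_n -> u in O, and ODF applied to v_n - v'_n transfers the convergence of P v_n to v_n. *)

theory Submission
  imports Defs
begin

section \<open>Minimisers and orthogonal projection in Hilbert space\<close>

(* Plays the role of weak compactness of bounded sets: elements of almost minimal norm in S k form a
   Cauchy sequence by the parallelogram identity. *)
lemma nested_closed_convex_Inter_nonempty:
  fixes S :: "nat \<Rightarrow> 'a::{real_inner,complete_space} set"
  assumes closed: "\<And>k. closed (S k)" and convex: "\<And>k. convex (S k)" and dec: "decseq S"
    and bound: "\<And>k. \<exists>x\<in>S k. norm x \<le> M"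
  shows "(\<Inter>k. S k) \<noteq> {}"
proof -
  \<comment> \<open>\<open>d k\<close> is the distance of \<open>S k\<close> from the origin. It
    increases as the sets shrink and stays below \<open>M\<close>, so it has a limit
    \<open>L\<close>.\<close>
  define d where "d k = Inf (norm ` S k)" for k
  have bdd: "bdd_below (norm ` S k)" for k
    by (auto intro!: bdd_belowI[of _ 0])
  have ne: "norm ` S k \<noteq> {}" for k using bound[of k] by auto
  have d_le: "d k \<le> norm x" if "x \<in> S k" for k x
    unfolding d_def using that bdd by (auto intro: cInf_lower)
  have d_nonneg: "0 \<le> d k" for k
    unfolding d_def using ne by (auto intro!: cInf_greatest)
  have d_M: "d k \<le> M" for k using bound[of k] d_le[of _ k] by force
  have "incseq d"
    unfolding incseq_def d_def
    using dec by (auto intro!: cInf_superset_mono bdd ne image_mono simp: decseq_def)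
  then obtain L where L: "d \<longlonglongrightarrow> L" "\<And>k. d k \<le> L"
    using incseq_convergent[of d M] d_M by auto
  have "\<exists>x\<in>S k. norm x < d k + inverse (real (Suc k))" for k
  proof -
    have "Inf (norm ` S k) < d k + inverse (real (Suc k))" unfolding d_def by simp
    then show ?thesis using cInf_lessD[OF ne] by fastforce
  qed
  then obtain x where x: "\<And>k. x k \<in> S k" "\<And>k. norm (x k) < d k + inverse (real (Suc k))"
    by metis
  have xj: "x j \<in> S k" if "k \<le> j" for j k
    using x(1)[of j] dec that by (auto simp: decseq_def)
  \<comment> \<open>The bound for the squared distance of \<open>x j\<close> and \<open>x k\<close>
    with \<open>k \<le> j\<close> that the parallelogram identity will give. It vanishes in the
    limit because \<open>d k\<close> and \<open>L + inverse (real (Suc k))\<close> both tend to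
    \<open>L\<close>.\<close>
  define e where "e k = 4 * ((L + inverse (real (Suc k)))\<^sup>2 - (d k)\<^sup>2)" for k
  have "e \<longlonglongrightarrow> 4 * ((L + 0)\<^sup>2 - L\<^sup>2)"
    unfolding e_def by (intro tendsto_intros L LIMSEQ_inverse_real_of_nat)
  then have e0: "e \<longlonglongrightarrow> 0" by simp
  have norm_le: "(norm (x j))\<^sup>2 \<le> (L + inverse (real (Suc k)))\<^sup>2" if "k \<le> j" for j k
  proof -
    have "inverse (real (Suc j)) \<le> inverse (real (Suc k))"
      using that by (intro le_imp_inverse_le) auto
    then have "norm (x j) \<le> L + inverse (real (Suc k))"
      using x(2)[of j] L(2)[of j] by linarith
    then show ?thesis by (intro power_mono) auto
  qed
  have dist_le: "(dist (x j) (x k))\<^sup>2 \<le> e k" if "k \<le> j" for j k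
  proof -
    \<comment> \<open>By convexity the midpoint stays in \<open>S k\<close>, so its norm is at least
      \<open>d k\<close>. This bounds the norm of the sum from below, and hence that of the
      difference from above.\<close>
    have "(1/2) *\<^sub>R x j + (1/2) *\<^sub>R x k \<in> S k"
      using convexD[OF convex xj[OF that] x(1), of "1/2" "1/2"] by simp
    then have "d k \<le> norm ((1/2) *\<^sub>R (x j + x k))"
      using d_le by (metis scaleR_add_right)
    then have "(d k)\<^sup>2 \<le> (norm ((1/2) *\<^sub>R (x j + x k)))\<^sup>2"
      using d_nonneg by (intro power_mono)
    then have "4 * (d k)\<^sup>2 \<le> (norm (x j + x k))\<^sup>2" by (simp add: power_divide)
    moreover have "(norm (x j - x k))\<^sup>2 + (norm (x j + x k))\<^sup>2 = 2 * (norm (x j))\<^sup>2 + 2 * (norm (x k))\<^sup>2"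
      by (simp add: power2_norm_eq_inner inner_simps inner_commute)
    ultimately show ?thesis
      using norm_le[OF that] norm_le[OF order_refl, of k] unfolding e_def dist_norm by argo
  qed
  have "Cauchy x"
  proof (rule metric_CauchyI)
    fix r :: real assume "r > 0"
    then have "(r/2)\<^sup>2 > 0" by simp
    from order_tendstoD(2)[OF e0 this] obtain K where K: "e K < (r/2)\<^sup>2"
      by (auto simp: eventually_sequentially)
    have *: "dist (x j) (x K) < r/2" if "K \<le> j" for j
      by (rule power2_less_imp_less) (use dist_le[OF that] K \<open>r > 0\<close> in auto)
    show "\<exists>K. \<forall>m\<ge>K. \<forall>n\<ge>K. dist (x m) (x n) < r"
      using dist_triangle_half_l[OF * *] by blast
  qed
  then obtain l where l: "x \<longlonglongrightarrow> l" using Cauchy_convergent convergent_def by blast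
  have "l \<in> S k" for k
    by (rule Lim_in_closed_set[OF closed _ _ l]) (auto simp: eventually_sequentially intro: xj)
  then show ?thesis by blast
qed

text \<open>A point \<open>w\<close> of \<open>W\<close> nearest to \<open>u\<close> exists as a
  common point of \<open>W\<close> and closed balls about \<open>u\<close> whose radii decrease to
  the distance. Minimality along each line through \<open>w\<close> in \<open>W\<close> makes the
  residual orthogonal to \<open>W\<close>.\<close>

lemma closed_subspace_orthogonal_decomposition:
  fixes W :: "'a::{real_inner,complete_space} set"
  assumes W: "subspace W" "closed W"
  obtains w where "w \<in> W" "\<And>w'. w' \<in> W \<Longrightarrow> (u - w) \<bullet> w' = 0"
proof -
  have ne: "W \<noteq> {}" using subspace_0[OF W(1)] by blast
  define S where "S k = W \<inter> cball u (infdist u W + inverse (real (Suc k)))" for k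
  have "(\<Inter>k. S k) \<noteq> {}"
  proof (rule nested_closed_convex_Inter_nonempty)
    show "closed (S k)" "convex (S k)" for k
      unfolding S_def using W subspace_imp_convex by (auto intro!: closed_Int convex_Int)
    show "decseq S"
    proof (unfold decseq_def, intro allI impI)
      fix k j :: nat assume "k \<le> j"
      then have "inverse (real (Suc j)) \<le> inverse (real (Suc k))"
        by (intro le_imp_inverse_le) auto
      then show "S j \<subseteq> S k"
        unfolding S_def by (intro Int_mono subset_refl subset_cball add_left_mono)
    qed
    show "\<exists>x\<in>S k. norm x \<le> norm u + infdist u W + 1" for k
    proof -
      have "Inf (dist u ` W) < infdist u W + inverse (real (Suc k))"
        using ne by (simp add: infdist_def)
      from cInf_lessD[OF _ this] ne
      obtain w where w: "w \<in> W" "dist u w < infdist u W + inverse (real (Suc k))"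
        by auto
      have "inverse (real (Suc k)) \<le> 1" by (simp add: field_simps)
      moreover have "norm w \<le> norm u + dist u w"
        by (metis dist_norm norm_minus_commute norm_triangle_sub)
      ultimately show ?thesis
        using w by (intro bexI[of _ w]) (auto simp: S_def)
    qed
  qed
  then obtain w where "\<forall>k. w \<in> S k" by blast
  then have w: "w \<in> W" "dist u w \<le> infdist u W + inverse (real (Suc k))" for k
    unfolding S_def by auto
  have "(\<lambda>k. infdist u W + inverse (real (Suc k))) \<longlonglongrightarrow> infdist u W + 0"
    by (intro tendsto_intros LIMSEQ_inverse_real_of_nat)
  then have "dist u w \<le> infdist u W + 0"
    by (rule LIMSEQ_le_const) (use w(2) in auto)
  then have min: "norm (u - w) \<le> norm (u - y)" if "y \<in> W" for y
    using infdist_le[OF that, of u] by (simp add: dist_norm)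
  have "(u - w) \<bullet> w' = 0" if w': "w' \<in> W" for w'
  proof (cases "w' = 0")
    case False
    define c where "c = (u - w) \<bullet> w'"
    \<comment> \<open>The minimiser of the quadratic \<open>norm ((u - w) - t *\<^sub>R w')\<close>
      squared. It lowers the value by \<open>c * c / (w' \<bullet> w')\<close>, which minimality of
      \<open>w\<close> forces to be at most 0.\<close>
    define t where "t = c / (w' \<bullet> w')"
    have pos: "w' \<bullet> w' > 0" using False by simp
    have "w + t *\<^sub>R w' \<in> W" using W(1) w(1) w' by (simp add: subspace_add subspace_scale)
    then have "(norm (u - w))\<^sup>2 \<le> (norm ((u - w) - t *\<^sub>R w'))\<^sup>2"
      using min by (intro power_mono) (auto simp: diff_diff_eq)
    also have "\<dots> = (norm (u - w))\<^sup>2 - 2 * t * c + t * t * (w' \<bullet> w')"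
      unfolding power2_norm_eq_inner c_def
      by (simp add: inner_simps inner_commute algebra_simps)
    also have "t * t * (w' \<bullet> w') = t * c" unfolding t_def using pos by simp
    finally have "c * c / (w' \<bullet> w') \<le> 0" unfolding t_def by simp
    then show ?thesis
      using pos by (metis c_def divide_le_0_iff linorder_not_less not_real_square_gt_zero)
  qed simp
  with w(1) that show thesis by blast
qed

section \<open>Finite dimensional subspaces\<close>

text \<open>Expansion in an orthogonal spanning set, with Fourier coefficients.\<close>

lemma span_finite_orthogonal_decomposition:
  fixes B :: "'a::real_inner set"
  assumes "finite B"
  obtains w where "w \<in> span B" "\<And>w'. w' \<in> span B \<Longrightarrow> (u - w) \<bullet> w' = 0"
proof -
  obtain C where C: "finite C" "span C = span B" "pairwise orthogonal C"
    using basis_orthogonal[OF assms] by blast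
  define w where "w = (\<Sum>b\<in>C. (b \<bullet> u / (b \<bullet> b)) *\<^sub>R b)"
  have "w \<in> span B"
    unfolding w_def C(2)[symmetric] by (intro span_sum span_scale span_base)
  moreover have "(u - w) \<bullet> w' = 0" if "w' \<in> span B" for w'
    using that unfolding C(2)[symmetric]
  proof (induction rule: span_induct_alt)
    case (step c x y)
    \<comment> \<open>Orthogonality leaves only the summand \<open>b = x\<close>. If
      \<open>x = 0\<close>, division by zero yields 0 and both sides still agree.\<close>
    have "w \<bullet> x = (\<Sum>b\<in>C. if b = x then u \<bullet> x else 0)"
      unfolding w_def inner_sum_left using C(3) step(1)
      by (intro sum.cong) (auto simp: pairwise_def orthogonal_def inner_commute)
    also have "\<dots> = u \<bullet> x" using C(1) step(1) by simp
    finally show ?case using step by (simp add: inner_simps)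
  qed simp
  ultimately show thesis using that by blast
qed

text \<open>A basis of \<open>T\<close> is an independent subset of a finite span, hence
  finite.\<close>

lemma finite_dimensional_subspace:
  assumes "finite_dimensional S" "subspace T" "T \<subseteq> S"
  shows "finite_dimensional T"
proof -
  obtain B where B: "finite B" "span B = S" using assms(1) unfolding finite_dimensional_def by blast
  obtain D where D: "D \<subseteq> T" "independent D" "T \<subseteq> span D"
    using basis_exists[of T] by metis
  have "finite D" using independent_span_bound[OF B(1) D(2)] D(1) assms(3) B(2) by blast
  moreover have "span D = T" using D assms(2) by (simp add: span_minimal subset_antisym)
  ultimately show ?thesis unfolding finite_dimensional_def by blast
qed

section \<open>Convergent subsequences, their limits, and approximation\<close>

lemma compact_map_on_convergent_subsequence:
  assumes "compact_map_on S f" "range p \<subseteq> S" "bounded (range p)"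
  obtains z s where "strict_mono (s :: nat \<Rightarrow> nat)" "(\<lambda>k. f (p (s k))) \<longlonglongrightarrow> z"
proof -
  have "compact (closure (f ` range p))"
    using assms unfolding compact_map_on_def by blast
  then have "seq_compact (closure (f ` range p))" by (rule compact_imp_seq_compact)
  moreover have "\<forall>k. f (p k) \<in> closure (f ` range p)"
    using closure_subset[of "f ` range p"] by auto
  ultimately obtain z s where "strict_mono (s :: nat \<Rightarrow> nat)" "((\<lambda>k. f (p k)) \<circ> s) \<longlonglongrightarrow> z"
    using seq_compactE by metis
  with that show thesis unfolding o_def by blast
qed

text \<open>Preimages of balls shrinking to \<open>z\<close> are closed, convex and nested, and each
  contains some \<open>p j\<close>, of norm at most \<open>M\<close>. A common point of them is
  mapped to \<open>z\<close>.\<close>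

lemma limit_of_bounded_image_in_range:
  fixes f :: "'a::{real_inner,complete_space} \<Rightarrow> 'b::real_normed_vector"
  assumes f: "bounded_linear f" and p: "bounded (range p)" and lim: "(\<lambda>k. f (p k)) \<longlonglongrightarrow> z"
  shows "z \<in> range f"
proof -
  obtain M where M: "\<And>k. norm (p k) \<le> M" using p by (auto simp: bounded_iff)
  interpret bounded_linear f by fact
  define S where "S k = f -` cball z (inverse (real (Suc k)))" for k
  have "(\<Inter>k. S k) \<noteq> {}"
  proof (rule nested_closed_convex_Inter_nonempty)
    show "closed (S k)" for k
      unfolding S_def by (intro closed_vimage closed_cball continuous_on continuous_on_id)
    show "convex (S k)" for k
      unfolding S_def by (intro convex_linear_vimage linear convex_cball)
    show "decseq S"
    proof (unfold decseq_def, intro allI impI)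
      fix k j :: nat assume "k \<le> j"
      then have "inverse (real (Suc j)) \<le> inverse (real (Suc k))"
        by (intro le_imp_inverse_le) auto
      then show "S j \<subseteq> S k" unfolding S_def by (intro vimage_mono subset_cball)
    qed
    show "\<exists>x\<in>S k. norm x \<le> M" for k
    proof -
      have "\<forall>\<^sub>F j in sequentially. dist (f (p j)) z < inverse (real (Suc k))"
        using lim by (intro tendstoD) auto
      then obtain j where "dist (f (p j)) z < inverse (real (Suc k))"
        by (auto simp: eventually_sequentially)
      then show ?thesis
        using M by (intro bexI[of _ "p j"]) (auto simp: S_def dist_commute)
    qed
  qed
  then obtain x where "\<forall>k. x \<in> S k" by blast
  then have "dist z (f x) \<le> inverse (real (Suc k))" for k
    unfolding S_def by auto
  then have "dist z (f x) \<le> 0"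
    using LIMSEQ_le_const[OF LIMSEQ_inverse_real_of_nat] by blast
  then show ?thesis by simp
qed

lemma approximating_sequence:
  fixes S :: "nat \<Rightarrow> 'a::real_normed_vector set"
  assumes "\<And>n. S n \<noteq> {}" and lim: "(\<lambda>n. INF u'\<in>S n. norm (u - u')) \<longlonglongrightarrow> 0"
  obtains y where "\<And>n. y n \<in> S n" "y \<longlonglongrightarrow> u"
proof -
  let ?i = "\<lambda>n. INF u'\<in>S n. norm (u - u')"
  \<comment> \<open>The infimum need not be attained; a slack tending to 0 is enough.\<close>
  have "\<exists>y\<in>S n. norm (u - y) < ?i n + inverse (real (Suc n))" for n
  proof -
    have "?i n < ?i n + inverse (real (Suc n))" by simp
    then show ?thesis
      using cInf_lessD[of "(\<lambda>u'. norm (u - u')) ` S n"] assms(1) by fastforce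
  qed
  then obtain y where y: "\<And>n. y n \<in> S n" "\<And>n. norm (u - y n) < ?i n + inverse (real (Suc n))"
    by metis
  have "(\<lambda>n. ?i n + inverse (real (Suc n))) \<longlonglongrightarrow> 0"
    using tendsto_add[OF lim LIMSEQ_inverse_real_of_nat] by simp
  moreover have "\<forall>\<^sub>F n in sequentially. norm (y n - u) \<le> ?i n + inverse (real (Suc n))"
    using y(2) by (intro always_eventually allI) (metis less_imp_le norm_minus_commute)
  ultimately have "(\<lambda>n. y n - u) \<longlonglongrightarrow> 0" by (rule Lim_null_comparison[rotated])
  then have "y \<longlonglongrightarrow> u" by (simp add: LIM_zero_iff)
  with y(1) that show thesis by blast
qed

section \<open>The kernel of the form, its complement and the projector\<close>

text \<open>Coercivity is built in through \<open>inner_eq\<close>: the sum of the pivot product and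
  the form is the scalar product of the complete space \<open>'x\<close>.\<close>

locale energy_form =
  fixes \<iota> :: "'x::{real_inner,complete_space} \<Rightarrow> 'o::real_inner"
    and a :: "'x \<Rightarrow> 'x \<Rightarrow> real"
  assumes inclusion: "bounded_linear \<iota>"
    and form: "bounded_bilinear a"
    and form_commute: "a u u' = a u' u"
    and form_nonneg: "0 \<le> a u u"
    and inner_eq: "u \<bullet> u' = \<iota> u \<bullet> \<iota> u' + a u u'"
begin

sublocale i: bounded_linear \<iota> by (rule inclusion)
sublocale a: bounded_bilinear a by (rule form)

abbreviation W :: "'x set" where "W \<equiv> form_kernel a UNIV"
abbreviation V :: "'x set" where "V \<equiv> kernel_complement \<iota> a UNIV"

lemma subspace_form_kernel:
  assumes "subspace S" shows "subspace (form_kernel a S)"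
  using assms unfolding form_kernel_def subspace_def
  by (auto simp: a.zero_left a.add_left a.scaleR_left)

lemma subspace_kernel_complement:
  assumes "subspace S" shows "subspace (kernel_complement \<iota> a S)"
  using assms unfolding kernel_complement_def subspace_def
  by (auto simp: i.zero i.add i.scaleR inner_add_left)

text \<open>The form vanishes between \<open>S\<close> and its kernel, so both scalar products agree
  there. Orthogonal projection in \<open>'x\<close> can therefore produce the components.\<close>

lemma kernel_complement_eq_orthogonal:
  "kernel_complement \<iota> a S = {u \<in> S. \<forall>w\<in>form_kernel a S. u \<bullet> w = 0}"
proof -
  have "u \<bullet> w = \<iota> u \<bullet> \<iota> w" if "u \<in> S" "w \<in> form_kernel a S" for u w
    using that form_commute[of u w] by (simp add: inner_eq form_kernel_def)
  then show ?thesis unfolding kernel_complement_def by auto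
qed

text \<open>The degenerate case of Cauchy-Schwarz: if \<open>a u u = 0\<close>, the form at
  \<open>t *\<^sub>R u + y\<close> is affine in \<open>t\<close>, and nonnegativity forces its slope
  to vanish.\<close>

lemma form_zero_imp_kernel:
  assumes "a u u = 0" shows "u \<in> W"
proof -
  have "a u y = 0" for y
  proof (rule ccontr)
    assume ne: "a u y \<noteq> 0"
    \<comment> \<open>Chosen so that the affine function takes the value -1.\<close>
    define t where "t = - (a y y + 1) / (2 * a u y)"
    have "0 \<le> a (t *\<^sub>R u + y) (t *\<^sub>R u + y)" by (rule form_nonneg)
    also have "\<dots> = 2 * t * a u y + a y y"
      using assms form_commute[of y u]
      by (simp add: a.add_left a.add_right a.scaleR_left a.scaleR_right)
    also have "\<dots> = -1" unfolding t_def using ne by (simp add: field_simps)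
    finally show False by simp
  qed
  then show ?thesis unfolding form_kernel_def by simp
qed

text \<open>Testing an element of the kernel over \<open>S\<close> against itself gives zero energy.
  Thus the discrete kernels lie in \<open>W\<close>, although the discrete complements need not lie
  in \<open>V\<close>.\<close>

lemma form_kernel_subset: "form_kernel a S \<subseteq> W"
  using form_zero_imp_kernel unfolding form_kernel_def by blast

lemma closed_form_kernel: "closed W"
proof -
  have "W = (\<Inter>y. {u. a u y = 0})" unfolding form_kernel_def by auto
  then show ?thesis
    by (auto intro!: closed_Collect_eq a.continuous_on continuous_intros)
qed

lemma orthogonal_kernel: "u \<in> V \<Longrightarrow> w \<in> W \<Longrightarrow> \<iota> u \<bullet> \<iota> w = 0"
  unfolding kernel_complement_def by blast

text \<open>\<open>W\<close> is closed in \<open>'x\<close>, so \<open>u\<close> can be projected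
  onto it there; \<open>p\<close> is the residual.\<close>

lemma decomposition:
  obtains p where "p \<in> V" "u - p \<in> W"
proof -
  obtain w where "w \<in> W" "\<And>w'. w' \<in> W \<Longrightarrow> (u - w) \<bullet> w' = 0"
    using closed_subspace_orthogonal_decomposition[OF subspace_form_kernel closed_form_kernel]
      subspace_UNIV by blast
  then show thesis
    by (intro that[of "u - w"]) (auto simp: kernel_complement_eq_orthogonal)
qed

lemma finite_dimensional_decomposition:
  assumes S: "subspace S" "finite_dimensional S" and u: "u \<in> S"
  obtains v where "v \<in> kernel_complement \<iota> a S" "u - v \<in> form_kernel a S"
proof -
  have sub: "form_kernel a S \<subseteq> S" unfolding form_kernel_def by blast
  obtain B where "finite B" "span B = form_kernel a S"
    using finite_dimensional_subspace[OF S(2) subspace_form_kernel[OF S(1)] sub]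
    unfolding finite_dimensional_def by blast
  then obtain w where w: "w \<in> form_kernel a S" "\<And>w'. w' \<in> form_kernel a S \<Longrightarrow> (u - w) \<bullet> w' = 0"
    using span_finite_orthogonal_decomposition by metis
  then show thesis
    using sub u S(1)
    by (intro that[of "u - w"]) (auto simp: kernel_complement_eq_orthogonal subspace_diff)
qed

text \<open>Pythagoras in both spaces, as \<open>V\<close> and \<open>W\<close> are orthogonal for
  both products. The first bound transfers convergence in \<open>'o\<close> to
  \<open>V\<close>-components, the second transfers boundedness in \<open>'x\<close>.\<close>

lemma norm_component_le:
  assumes "p \<in> V" "x - p \<in> W"
  shows "norm (\<iota> p) \<le> norm (\<iota> x)" and "norm p \<le> norm x"
proof -
  have *: "norm y \<le> norm (y + z)" if "y \<bullet> z = 0" for y z :: "'b::real_inner"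
    by (rule power2_le_imp_le)
      (use that in \<open>auto simp: power2_norm_eq_inner inner_simps inner_commute\<close>)
  show "norm (\<iota> p) \<le> norm (\<iota> x)"
    using *[OF orthogonal_kernel[OF assms]] by (simp add: i.diff)
  have "p \<bullet> (x - p) = 0" using assms by (auto simp: kernel_complement_eq_orthogonal)
  from *[OF this] show "norm p \<le> norm x" by simp
qed

lemma closure_complement_orthogonal:
  assumes "y \<in> closure (\<iota> ` V)" "w \<in> W"
  shows "y \<bullet> \<iota> w = 0"
proof -
  have "closed {y. y \<bullet> \<iota> w = 0}" by (intro closed_Collect_eq continuous_intros)
  moreover have "\<iota> ` V \<subseteq> {y. y \<bullet> \<iota> w = 0}" using assms(2) orthogonal_kernel by auto
  ultimately show ?thesis using closure_minimal assms(1) by blast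
qed

text \<open>On the image of \<open>'x\<close> the projector is read off from the splitting into
  \<open>V\<close> and \<open>W\<close>. The candidate value is unique because the difference of two
  candidates lies in the image of \<open>W\<close> and is orthogonal to it.\<close>

lemma kernel_projector_eq:
  assumes p: "p \<in> V" "x - p \<in> W"
  shows "kernel_projector \<iota> a (\<iota> x) = \<iota> p"
  unfolding kernel_projector_def projector_def
proof (rule the_equality)
  show "\<iota> p \<in> closure (\<iota> ` V) \<and> \<iota> x - \<iota> p \<in> \<iota> ` W"
    using p closure_subset[of "\<iota> ` V"] by (auto simp flip: i.diff)
  fix y assume y: "y \<in> closure (\<iota> ` V) \<and> \<iota> x - y \<in> \<iota> ` W"
  then obtain w where w: "w \<in> W" "\<iota> x - y = \<iota> w" by blast
  \<comment> \<open>The element of \<open>W\<close> whose image is the difference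
    \<open>y - \<iota> p\<close>.\<close>
  define w' where "w' = x - p - w"
  have w': "w' \<in> W"
    unfolding w'_def using p(2) w(1) subspace_form_kernel by (simp add: subspace_diff)
  have eq: "y - \<iota> p = \<iota> w'" unfolding w'_def i.diff w(2)[symmetric] by simp
  have "(y - \<iota> p) \<bullet> \<iota> w' = 0"
    using closure_complement_orthogonal[OF _ w'] y orthogonal_kernel[OF p(1) w']
    by (simp add: inner_diff_left)
  then show "y = \<iota> p" unfolding eq[symmetric] by simp
qed

section \<open>Limits of continuous and discrete complements\<close>

text \<open>Boundedness in \<open>'x\<close> gives the limit a preimage \<open>u\<close>, and
  orthogonality to \<open>W\<close> survives the limit. So the limit comes from \<open>V\<close>
  itself, not merely from the closure of its image.\<close>

lemma complement_limit:
  assumes "range p \<subseteq> V" "bounded (range p)" "(\<lambda>k. \<iota> (p k)) \<longlonglongrightarrow> z"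
  obtains u where "u \<in> V" "z = \<iota> u"
proof -
  obtain u where u: "z = \<iota> u"
    using limit_of_bounded_image_in_range[OF inclusion assms(2,3)] by blast
  have "z \<in> closure (\<iota> ` V)"
    using assms(1,3) by (intro closure_sequential[THEN iffD2] exI[of _ "\<lambda>k. \<iota> (p k)"]) auto
  then have "\<iota> u \<bullet> \<iota> w = 0" if "w \<in> W" for w
    using closure_complement_orthogonal[OF _ that] u by simp
  then have "u \<in> V" unfolding kernel_complement_def by simp
  with u that show thesis by blast
qed

lemma discrete_complement_approximation:
  assumes S: "\<And>n. subspace (S n)" "\<And>n. finite_dimensional (S n)"
    and AS: "(\<lambda>n. INF u'\<in>S n. norm (u - u')) \<longlonglongrightarrow> 0"
    and u: "u \<in> V"
  obtains v where "\<And>n. v n \<in> kernel_complement \<iota> a (S n)" "(\<lambda>n. \<iota> (v n)) \<longlonglongrightarrow> \<iota> u"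
proof -
  obtain y where y: "\<And>n. y n \<in> S n" "y \<longlonglongrightarrow> u"
    using approximating_sequence[OF _ AS] S(1) subspace_0 by (metis empty_iff)
  have "\<exists>v. v \<in> kernel_complement \<iota> a (S n) \<and> y n - v \<in> form_kernel a (S n)" for n
    using finite_dimensional_decomposition[OF S y(1)] by metis
  then obtain v where v: "\<And>n. v n \<in> kernel_complement \<iota> a (S n)"
      "\<And>n. y n - v n \<in> form_kernel a (S n)" by metis
  have le: "norm (\<iota> (y n - v n)) \<le> norm (\<iota> (y n) - \<iota> u)" for n
  proof -
    let ?w = "y n - v n"
    have "\<iota> (v n) \<bullet> \<iota> ?w = 0" using v[of n] unfolding kernel_complement_def by blast
    moreover have "\<iota> u \<bullet> \<iota> ?w = 0"
      using orthogonal_kernel[OF u] form_kernel_subset v(2) by blast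
    \<comment> \<open>The kernel component is orthogonal to \<open>\<iota> (v n)\<close> and to
      \<open>\<iota> u\<close>, so only the approximation error is paired with it. Cauchy-Schwarz
      then bounds the component by that error.\<close>
    ultimately have "(norm (\<iota> ?w))\<^sup>2 = (\<iota> (y n) - \<iota> u) \<bullet> \<iota> ?w"
      by (simp add: power2_norm_eq_inner i.diff inner_diff_left)
    also have "\<dots> \<le> norm (\<iota> (y n) - \<iota> u) * norm (\<iota> ?w)" by (rule norm_cauchy_schwarz)
    finally show ?thesis
      by (cases "\<iota> ?w = 0") (auto simp: power2_eq_square)
  qed
  have lim: "(\<lambda>n. \<iota> (y n)) \<longlonglongrightarrow> \<iota> u" using y(2) by (rule i.tendsto)
  then have "(\<lambda>n. norm (\<iota> (y n) - \<iota> u)) \<longlonglongrightarrow> 0"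
    by (simp add: LIM_zero_iff tendsto_norm_zero_iff)
  then have "(\<lambda>n. \<iota> (y n - v n)) \<longlonglongrightarrow> 0"
    by (rule Lim_null_comparison[rotated]) (use le in auto)
  from tendsto_diff[OF lim this] have "(\<lambda>n. \<iota> (v n)) \<longlonglongrightarrow> \<iota> u" by (simp add: i.diff)
  with v(1) that show thesis by blast
qed

text \<open>The \<open>V\<close>-components of \<open>v k\<close> and of the approximations of
  \<open>u\<close> have the same limit. The difference of the two sequences lies in the discrete
  complement with index \<open>r k\<close>, where ODF bounds it by the difference of these
  components.\<close>

lemma discrete_convergence:
  assumes S: "\<And>n. subspace (S n)" "\<And>n. finite_dimensional (S n)"
    and AS: "(\<lambda>n. INF u'\<in>S n. norm (u - u')) \<longlonglongrightarrow> 0"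
    and ODF: "\<And>n v. v \<in> kernel_complement \<iota> a (S n) \<Longrightarrow>
                norm (\<iota> v) \<le> C * norm (kernel_projector \<iota> a (\<iota> v))"
    and r: "strict_mono r" and v: "\<And>k. v k \<in> kernel_complement \<iota> a (S (r k))"
    and p: "\<And>k. p k \<in> V" "\<And>k. v k - p k \<in> W" and u: "u \<in> V" "(\<lambda>k. \<iota> (p k)) \<longlonglongrightarrow> \<iota> u"
  shows "(\<lambda>k. \<iota> (v k)) \<longlonglongrightarrow> \<iota> u"
proof -
  have subW: "subspace W" and subV: "subspace V"
    by (auto intro: subspace_form_kernel subspace_kernel_complement)
  obtain v' where v': "\<And>n. v' n \<in> kernel_complement \<iota> a (S n)" "(\<lambda>n. \<iota> (v' n)) \<longlonglongrightarrow> \<iota> u"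
    using discrete_complement_approximation[OF S AS u(1)] by metis
  have lim: "(\<lambda>k. \<iota> (v' (r k))) \<longlonglongrightarrow> \<iota> u"
    using LIMSEQ_subseq_LIMSEQ[OF v'(2) r] by (simp add: o_def)
  have "\<exists>q. q \<in> V \<and> v' (r k) - q \<in> W" for k using decomposition by metis
  then obtain q where q: "\<And>k. q k \<in> V" "\<And>k. v' (r k) - q k \<in> W" by metis
  \<comment> \<open>Since \<open>u\<close> is its own \<open>V\<close>-component,
    \<open>q k - u\<close> is that of \<open>v' (r k) - u\<close>.\<close>
  have "norm (\<iota> (q k) - \<iota> u) \<le> norm (\<iota> (v' (r k)) - \<iota> u)" for k
    using norm_component_le(1)[of "q k - u" "v' (r k) - u"] q[of k] u(1) subV
    by (simp add: subspace_diff i.diff)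
  then have "\<forall>\<^sub>F k in sequentially. norm (\<iota> (q k) - \<iota> u) \<le> norm (\<iota> (v' (r k)) - \<iota> u)"
    by simp
  moreover have "(\<lambda>k. norm (\<iota> (v' (r k)) - \<iota> u)) \<longlonglongrightarrow> 0"
    by (rule tendsto_norm_zero[OF LIM_zero[OF lim]])
  ultimately have "(\<lambda>k. \<iota> (q k) - \<iota> u) \<longlonglongrightarrow> 0"
    by (rule Lim_null_comparison)
  then have "(\<lambda>k. \<iota> (q k)) \<longlonglongrightarrow> \<iota> u" by (simp add: LIM_zero_iff)
  from tendsto_diff[OF u(2) this] have "(\<lambda>k. \<iota> (p k) - \<iota> (q k)) \<longlonglongrightarrow> 0" by simp
  then have lim0: "(\<lambda>k. C * norm (\<iota> (p k) - \<iota> (q k))) \<longlonglongrightarrow> 0"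
    by (intro tendsto_mult_right_zero tendsto_norm_zero)
  have "norm (\<iota> (v k) - \<iota> (v' (r k))) \<le> C * norm (\<iota> (p k) - \<iota> (q k))" for k
  proof -
    \<comment> \<open>Subtracting the two splittings gives the splitting of
      \<open>v k - v' (r k)\<close>, from which the projector is read off.\<close>
    have "(v k - p k) - (v' (r k) - q k) \<in> W" using p(2) q(2) subW by (simp add: subspace_diff)
    then have "(v k - v' (r k)) - (p k - q k) \<in> W" by (simp add: algebra_simps)
    moreover have "p k - q k \<in> V" using p(1) q(1) subV by (simp add: subspace_diff)
    ultimately have "kernel_projector \<iota> a (\<iota> (v k - v' (r k))) = \<iota> (p k - q k)"
      by (intro kernel_projector_eq)
    moreover have "v k - v' (r k) \<in> kernel_complement \<iota> a (S (r k))"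
      using v v'(1) subspace_kernel_complement[OF S(1)] by (simp add: subspace_diff)
    ultimately show ?thesis using ODF by (metis i.diff)
  qed
  then have "(\<lambda>k. \<iota> (v k) - \<iota> (v' (r k))) \<longlonglongrightarrow> 0"
    by (intro Lim_null_comparison[OF always_eventually lim0] allI)
  from tendsto_add[OF this lim] show ?thesis by simp
qed

end

section \<open>Extraction of the convergent subsequence\<close>

theorem proposition8:
  fixes \<iota> :: "'x::{real_inner,complete_space} \<Rightarrow> 'o::{real_inner,polish_space}"
    and a :: "'x \<Rightarrow> 'x \<Rightarrow> real"
    and Xn :: "nat \<Rightarrow> 'x set"
  assumes "\<not> finite_dimensional (UNIV :: 'o set)"
    and "bounded_linear \<iota>"
    and "inj \<iota>"
    and "closure (range \<iota>) = UNIV"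
    and "bounded_bilinear a"
    and "\<And>u u'. a u u' = a u' u"
    and "\<And>u. a u u \<ge> 0"
    and "\<And>u u'. u \<bullet> u' = \<iota> u \<bullet> \<iota> u' + a u u'"
    and "compact_map_on (kernel_complement \<iota> a UNIV) \<iota>"
    and "\<And>n. subspace (Xn n)"
    and "\<And>n. finite_dimensional (Xn n)"
    and AS: "\<And>u. (\<lambda>n. INF u'\<in>Xn n. norm (u - u')) \<longlonglongrightarrow> 0"
    and ODF: "\<exists>C>0. \<forall>n. \<forall>v\<in>kernel_complement \<iota> a (Xn n).
                norm (\<iota> v) \<le> C * norm (kernel_projector \<iota> a (\<iota> v))"
  shows "\<forall>N v. infinite N \<and> (\<forall>n\<in>N. v n \<in> kernel_complement \<iota> a (Xn n)) \<and> bounded (v ` N) \<longrightarrow>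
           (\<exists>r :: nat \<Rightarrow> nat. strict_mono r \<and> range r \<subseteq> N \<and>
              (\<exists>u\<in>kernel_complement \<iota> a UNIV. (\<lambda>k. \<iota> (v (r k))) \<longlonglongrightarrow> \<iota> u))"
proof (intro allI impI, elim conjE)
  fix N and v :: "nat \<Rightarrow> 'x"
  assume N: "infinite N" and v: "\<forall>n\<in>N. v n \<in> kernel_complement \<iota> a (Xn n)"
    and bdd: "bounded (v ` N)"
  interpret energy_form \<iota> a by (rule energy_form.intro) (fact assms)+
  obtain C where C: "\<And>n v. v \<in> kernel_complement \<iota> a (Xn n) \<Longrightarrow>
      norm (\<iota> v) \<le> C * norm (kernel_projector \<iota> a (\<iota> v))"
    using ODF by blast
  \<comment> \<open>The increasing enumeration of \<open>N\<close> turns the family into a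
    sequence.\<close>
  define e where "e = enumerate N"
  have e: "strict_mono e" "\<And>k. e k \<in> N"
    unfolding e_def using N by (auto simp: strict_mono_enumerate enumerate_in_set)
  have "\<exists>p. p \<in> V \<and> v (e k) - p \<in> W" for k using decomposition by metis
  then obtain p where p: "\<And>k. p k \<in> V" "\<And>k. v (e k) - p k \<in> W"
    by metis
  obtain M where "\<And>n. n \<in> N \<Longrightarrow> norm (v n) \<le> M" using bdd by (auto simp: bounded_iff)
  then have pM: "norm (p k) \<le> M" for k
    using order_trans[OF norm_component_le(2)[OF p]] e(2) by metis
  then have "bounded (range p)" by (auto simp: bounded_iff)
  with p(1) obtain z s where s: "strict_mono s" "(\<lambda>k. \<iota> (p (s k))) \<longlonglongrightarrow> z"
    using compact_map_on_convergent_subsequence[OF \<open>compact_map_on V \<iota>\<close>] by (metis image_subsetI)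
  have "bounded (range (\<lambda>k. p (s k)))" using pM by (auto simp: bounded_iff)
  then obtain u where u: "u \<in> V" "z = \<iota> u"
    using complement_limit[OF _ _ s(2)] p(1) by blast
  \<comment> \<open>Index map of the final subsequence: first \<open>s\<close> from compactness,
    then \<open>e\<close> into \<open>N\<close>.\<close>
  have r: "strict_mono (e \<circ> s)" using e(1) s(1) by (rule strict_mono_o)
  have "(\<lambda>k. \<iota> (v ((e \<circ> s) k))) \<longlonglongrightarrow> \<iota> u"
    using discrete_convergence[OF assms(10,11) AS C r, where v = "\<lambda>k. v ((e \<circ> s) k)"
        and p = "\<lambda>k. p (s k)" and u = u]
      v e(2) p s(2) u by simp
  with r u(1) e(2) show "\<exists>r :: nat \<Rightarrow> nat. strict_mono r \<and> range r \<subseteq> N \<and>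
      (\<exists>u\<in>V. (\<lambda>k. \<iota> (v (r k))) \<longlonglongrightarrow> \<iota> u)"
    by (intro exI[of _ "e \<circ> s"]) auto
qed

end
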